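(* Let $(X,f)$ be a dynamical system ($X$ not assumed Hausdorff). (a) If $X$ is a perfect $T_1$ space and $X$ has a dense orbit sequence, then for every pair $U,V$ of nonempty open subsets of $X$ the set $N_+(U,V)$ is nonempty. (b) If $f$ is surjective and $x\in X$ has forward orbit $O(x)$ dense in $X$, then $\omega f(x)=X$.
   Context: A dynamical system $(X,f)$ is a continuous map $f\colon X\to X$ on a nonempty topological space $X$. $\mathbb N$ is the set of nonnegative integers. $X$ is perfect if it has no isolated points, i.e. no singleton $\{x\}$ is open. An orbit sequence is either a bi-infinite sequence $\langle x_k:k\in\mathbb Z\rangle$ in $X$ with $f(x_k)=x_{k+1}$ for all $k$, or a sequence $\langle x_k:k\ge n\rangle$ (for some $n\in\mathbb Z$) with $f(x_k)=x_{k+1}$ for $k\ge n$ and $f^{-1}(\{x_n\})=\varnothing$; it is dense if its set of elements is dense in $X$. $O(x)=\{f^k(x):k\in\mathbb N\}$ and $\omega f(x)=\bigcap_{n\ge0}\overline{\{f^k(x):k\ge n\}}$. For $A,B\subset X$, $N_+(A,B)=\{k\in\mathbb N: A\cap f^{-k}(B)\ne\varnothing\}$, where $f^{-k}(B)$ is the preimage of $B$ under $f^k$. *)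

theory Defs
  imports "HOL-Analysis.Analysis"
begin

(* The space is an abstract topology whose points form topspace X; the values of f
   outside topspace X are irrelevant, so all preimages are taken inside topspace X. *)

definition dynamical_system :: "'a topology \<Rightarrow> ('a \<Rightarrow> 'a) \<Rightarrow> bool" where
  "dynamical_system X f \<longleftrightarrow> topspace X \<noteq> {} \<and> continuous_map X X f"

definition perfect_topology :: "'a topology \<Rightarrow> bool" where
  "perfect_topology X \<longleftrightarrow> (\<forall>x\<in>topspace X. \<not> openin X {x})"

definition dense_subset :: "'a topology \<Rightarrow> 'a set \<Rightarrow> bool" where
  "dense_subset X S \<longleftrightarrow> S \<subseteq> topspace X \<and> X closure_of S = topspace X"

(* The sequence of the x k with k in I. The index set I is either all of the integers or
   a half-line {n..}; in the latter case the initial point x n has no preimage under f.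
   The values of x outside I play no role. *)
definition orbit_sequence :: "'a topology \<Rightarrow> ('a \<Rightarrow> 'a) \<Rightarrow> int set \<Rightarrow> (int \<Rightarrow> 'a) \<Rightarrow> bool" where
  "orbit_sequence X f I x \<longleftrightarrow>
     (I = UNIV \<or> (\<exists>n. I = {n..} \<and> {y \<in> topspace X. f y = x n} = {})) \<and>
     (\<forall>k\<in>I. x k \<in> topspace X \<and> f (x k) = x (k + 1))"

definition has_dense_orbit_sequence :: "'a topology \<Rightarrow> ('a \<Rightarrow> 'a) \<Rightarrow> bool" where
  "has_dense_orbit_sequence X f \<longleftrightarrow> (\<exists>I x. orbit_sequence X f I x \<and> dense_subset X (x ` I))"

definition forward_orbit :: "('a \<Rightarrow> 'a) \<Rightarrow> 'a \<Rightarrow> 'a set" where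
  "forward_orbit f x = {(f ^^ k) x | k. True}"

definition omega_limit :: "'a topology \<Rightarrow> ('a \<Rightarrow> 'a) \<Rightarrow> 'a \<Rightarrow> 'a set" where
  "omega_limit X f x = (\<Inter>n. X closure_of {(f ^^ k) x | k. n \<le> k})"

definition hitting_times :: "'a topology \<Rightarrow> ('a \<Rightarrow> 'a) \<Rightarrow> 'a set \<Rightarrow> 'a set \<Rightarrow> nat set" where
  "hitting_times X f A B = {k. A \<inter> {y \<in> topspace X. (f ^^ k) y \<in> B} \<noteq> {}}"

end

theory Submission
  imports Defs
begin

text \<open>
  In a perfect \<open>T\<^sub>1\<close> space a nonempty open set meets every dense set in infinitely many
  points, so an open set is visited by a dense orbit sequence at infinitely many times. If no orbit
  leads from \<open>U\<close> to \<open>V\<close>, then every visit to \<open>U\<close> comes after every visit to \<open>V\<close>. Two visits, to \<open>V\<close>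
  at time \<open>j\<close> and to \<open>U\<close> at time \<open>i\<close> with \<open>j < i\<close>, make the open set \<open>V \<inter> f\<^sup>-\<^sup>k(U)\<close> with \<open>k = i - j\<close>
  nonempty, yet its visiting times lie between \<open>j - k\<close> and \<open>i\<close>, a contradiction.

  For the second part, \<open>X = f\<^sup>n(X) = f\<^sup>n(closure (O(x)))\<close> is contained in the closure of \<open>f\<^sup>n(O(x))\<close>,
  so every tail of the orbit is dense.
\<close>

lemma continuous_map_funpow:
  assumes "continuous_map X X f"
  shows "continuous_map X X (f ^^ n)"
proof (induction n)
  case 0
  show ?case by (simp add: id_def)
next
  case (Suc n)
  then have "continuous_map X X (f \<circ> f ^^ n)" using assms by (rule continuous_map_compose)
  then show ?case by (simp only: funpow.simps)
qed

text \<open>In a T1 space an open set stays open after deleting finitely many points. If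
  \<open>W \<inter> D\<close> were finite, deleting it from \<open>W\<close> would leave an open set
  missing \<open>D\<close>, hence the empty set; so \<open>W\<close> would be finite, and deleting
  all its points but one would isolate that point.\<close>

lemma perfect_t1_infinite_dense_Int_open:
  assumes "perfect_topology X" "t1_space X" "dense_subset X D" "openin X W" "W \<noteq> {}"
  shows "infinite (W \<inter> D)"
proof
  assume fin: "finite (W \<inter> D)"
  have sub: "W \<subseteq> topspace X" using assms(4) by (rule openin_subset)
  have del: "openin X (W - F)" if "finite F" for F
  proof -
    \<comment> \<open>\<open>F\<close> may contain points outside the space, so only its trace is
      closed.\<close>
    have "closedin X (F \<inter> topspace X)"
      using that assms(2) unfolding t1_space_closedin_finite by auto
    with assms(4) have "openin X (W - (F \<inter> topspace X))" by (rule openin_diff)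
    moreover have "W - (F \<inter> topspace X) = W - F" using sub by blast
    ultimately show ?thesis by simp
  qed
  have dense: "D \<inter> T \<noteq> {}" if "openin X T" "T \<noteq> {}" for T
    using assms(3) that by (simp add: dense_subset_def dense_intersects_open)
  have "W - W \<inter> D = {}"
  proof (rule ccontr)
    assume "W - W \<inter> D \<noteq> {}"
    with del[OF fin] have "D \<inter> (W - W \<inter> D) \<noteq> {}" by (rule dense)
    then show False by blast
  qed
  then have "W \<subseteq> D" by blast
  then have finW: "finite W" using fin by (simp add: Int_absorb2)
  obtain p where p: "p \<in> W" using assms(5) by blast
  have "openin X (W - (W - {p}))" using finW by (intro del) simp
  moreover have "W - (W - {p}) = {p}" using p by blast
  ultimately show False using assms(1) p sub by (auto simp: perfect_topology_def)
qed

lemma orbit_sequence_funpow: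
  assumes "orbit_sequence X f I x" "i \<in> I"
  shows "i + int k \<in> I \<and> x (i + int k) = (f ^^ k) (x i)"
proof (induction k)
  case 0
  show ?case using assms(2) by simp
next
  case (Suc k)
  have "f (x m) = x (m + 1)" if "m \<in> I" for m
    using assms(1) that by (simp add: orbit_sequence_def)
  then have "f (x (i + int k)) = x (i + int k + 1)" using Suc by blast
  \<comment> \<open>Both admissible forms of the index set are closed upwards.\<close>
  moreover have "i + int (Suc k) \<in> I"
    using assms by (auto simp: orbit_sequence_def)
  ultimately show ?case using Suc by (simp add: algebra_simps)
qed

text \<open>Infinitely many distinct points of the sequence lie in \<open>W\<close>, and each needs
  its own time.\<close>

lemma infinite_visit_times:
  assumes "perfect_topology X" "t1_space X" "dense_subset X (x ` I)" "openin X W" "W \<noteq> {}"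
  shows "infinite {i \<in> I. x i \<in> W}"
proof
  assume "finite {i \<in> I. x i \<in> W}"
  then have "finite (x ` {i \<in> I. x i \<in> W})" by (rule finite_imageI)
  moreover have "x ` {i \<in> I. x i \<in> W} = W \<inter> x ` I" by blast
  ultimately show False
    using perfect_t1_infinite_dense_Int_open[OF assms] by simp
qed

lemma hitting_times_nonempty_of_dense_orbit_sequence:
  assumes "continuous_map X X f" "perfect_topology X" "t1_space X" "has_dense_orbit_sequence X f"
    and U: "openin X U" "U \<noteq> {}" and V: "openin X V" "V \<noteq> {}"
  shows "hitting_times X f U V \<noteq> {}"
proof
  assume empty: "hitting_times X f U V = {}"
  obtain I x where orb: "orbit_sequence X f I x" and dense: "dense_subset X (x ` I)"
    using assms(4) by (auto simp: has_dense_orbit_sequence_def)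
  note inf = infinite_visit_times[OF assms(2,3) dense]
  \<comment> \<open>Otherwise the iterate of order \<open>j - i\<close> carries \<open>x i\<close>
    in \<open>U\<close> to \<open>x j\<close> in \<open>V\<close>, which is a hitting time.\<close>
  have order: "j < i" if "i \<in> I" "x i \<in> U" "j \<in> I" "x j \<in> V" for i j
  proof (rule ccontr)
    assume "\<not> j < i"
    then have "x j = (f ^^ nat (j - i)) (x i)"
      using orbit_sequence_funpow[OF orb that(1), of "nat (j - i)"] by simp
    moreover have "x i \<in> topspace X" using that(1) orb by (auto simp: orbit_sequence_def)
    ultimately have "nat (j - i) \<in> hitting_times X f U V"
      using that by (auto simp: hitting_times_def)
    then show False using empty by blast
  qed
  obtain i where i: "i \<in> I" "x i \<in> U"
    using infinite_imp_nonempty[OF inf[OF U]] by blast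
  obtain j where j: "j \<in> I" "x j \<in> V"
    using infinite_imp_nonempty[OF inf[OF V]] by blast
  \<comment> \<open>By \<open>order\<close>, \<open>nat\<close> does not truncate here, so
    \<open>j + int k = i\<close>.\<close>
  define k where "k = nat (i - j)"
  define W where "W = V \<inter> {y \<in> topspace X. (f ^^ k) y \<in> U}"
  have "openin X W"
    unfolding W_def
    using V(1) openin_continuous_map_preimage[OF continuous_map_funpow[OF assms(1)] U(1)]
    by (rule openin_Int)
  moreover have "x j \<in> W"
    using orbit_sequence_funpow[OF orb j(1), of k] order[OF i j] i j openin_subset[OF V(1)]
    by (auto simp: W_def k_def)
  ultimately have "infinite {l \<in> I. x l \<in> W}" using inf by blast
  \<comment> \<open>Apply \<open>order\<close> twice: \<open>x l\<close> in \<open>V\<close> puts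
    \<open>l\<close> before \<open>i\<close>, and \<open>x (l + int k)\<close> in \<open>U\<close>
    puts \<open>l + int k\<close> after \<open>j\<close>.\<close>
  moreover have "{l \<in> I. x l \<in> W} \<subseteq> {j - int k..i}"
  proof
    fix l assume l: "l \<in> {l \<in> I. x l \<in> W}"
    then have "l < i" using order[OF i] by (auto simp: W_def)
    moreover have "j < l + int k"
      using l orbit_sequence_funpow[OF orb, of l k] order[OF _ _ j] by (auto simp: W_def)
    ultimately show "l \<in> {j - int k..i}" by simp
  qed
  ultimately show False using finite_subset by blast
qed

lemma omega_limit_eq_topspace:
  assumes "continuous_map X X f" "f ` topspace X = topspace X" "dense_subset X (forward_orbit f x)"
  shows "omega_limit X f x = topspace X"
proof -
  have tail: "X closure_of {(f ^^ k) x | k. n \<le> k} = topspace X" for n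
  proof
    have "topspace X = (f ^^ n) ` topspace X"
    proof (induction n)
      case (Suc n)
      have "(f ^^ Suc n) ` topspace X = f ` (f ^^ n) ` topspace X" by (simp add: image_comp)
      then show ?case using Suc assms(2) by simp
    qed simp
    also have "\<dots> = (f ^^ n) ` (X closure_of forward_orbit f x)"
      using assms(3) by (simp add: dense_subset_def)
    also have "\<dots> \<subseteq> X closure_of ((f ^^ n) ` forward_orbit f x)"
      using continuous_map_funpow[OF assms(1)]
      by (rule continuous_map_image_closure_subset)
    also have "\<dots> \<subseteq> X closure_of {(f ^^ k) x | k. n \<le> k}"
    proof (rule closure_of_mono)
      \<comment> \<open>Applying \<open>f ^^ n\<close> shifts orbit indices by \<open>n\<close>, so
        the image lands in the tail.\<close>
      have "(f ^^ n) ((f ^^ k) x) \<in> {(f ^^ k) x | k. n \<le> k}" for k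
        by (rule CollectI, rule exI[of _ "n + k"]) (simp add: funpow_add)
      then show "(f ^^ n) ` forward_orbit f x \<subseteq> {(f ^^ k) x | k. n \<le> k}"
        unfolding forward_orbit_def by blast
    qed
    finally show "topspace X \<subseteq> X closure_of {(f ^^ k) x | k. n \<le> k}" .
  qed (rule closure_of_subset_topspace)
  then show ?thesis by (simp add: omega_limit_def)
qed

theorem proposition9p1:
  fixes X :: "'a topology" and f :: "'a \<Rightarrow> 'a"
  assumes "dynamical_system X f"
  shows "(perfect_topology X \<and> t1_space X \<and> has_dense_orbit_sequence X f \<longrightarrow>
            (\<forall>U V. openin X U \<and> U \<noteq> {} \<and> openin X V \<and> V \<noteq> {} \<longrightarrow>
               hitting_times X f U V \<noteq> {}))
       \<and> (f ` topspace X = topspace X \<longrightarrow>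
            (\<forall>x\<in>topspace X. dense_subset X (forward_orbit f x) \<longrightarrow>
               omega_limit X f x = topspace X))"
proof -
  have "continuous_map X X f" using assms by (simp add: dynamical_system_def)
  note hitting_times_nonempty_of_dense_orbit_sequence[OF this] omega_limit_eq_topspace[OF this]
  then show ?thesis by simp
qed

end
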